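(* Let $n\geq 1$ and $k\geq 0$ be integers, and let $X=(X_{ij})_{i,j=1}^n$ be a matrix of independent commuting indeterminates. For each multiindex $\alpha\in\mathbb{N}^{[n]\times[n]}$ with $|\alpha|=kn$, let $c_\alpha$ denote the coefficient of the monomial $X^\alpha$ in the polynomial $\det(X)^k$. Then $$\sum_{|\alpha|=kn} c_\alpha^2\,\alpha! \;=\; \frac{k!\,(k+1)!\cdots(k+n-1)!}{0!\,1!\cdots(n-1)!}.$$
   Context: Here $[n]=\{1,\ldots,n\}$. For a multiindex of nonnegative integers $\alpha=(\alpha_{ij})\in\mathbb{N}^{[n]\times[n]}$, we write $|\alpha|=\sum_{i,j=1}^n\alpha_{ij}$, $X^\alpha=\prod_{i,j=1}^n X_{ij}^{\alpha_{ij}}$, and $\alpha!=\prod_{i,j=1}^n\alpha_{ij}!$. *)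

theory Defs
  imports "HOL-Library.Poly_Mapping" "Jordan_Normal_Form.Determinant"
begin

text \<open>
  Multiindices are finitely supported functions on pairs of indices, and polynomials over
  the rationals are finitely supported functions from multiindices to coefficients; the product
  of \<^theory>\<open>HOL-Library.Poly_Mapping\<close> is the convolution product, i.e. the product of polynomials.
  Row and column indices run over \<open>0, \<dots>, n - 1\<close>, as is usual for \<^typ>\<open>'a mat\<close>.
\<close>

type_synonym multiindex = "(nat \<times> nat) \<Rightarrow>\<^sub>0 nat"
type_synonym mpoly = "multiindex \<Rightarrow>\<^sub>0 rat"

definition monomial :: "multiindex \<Rightarrow> mpoly" where
  "monomial \<alpha> = Poly_Mapping.single \<alpha> 1"

definition indet :: "nat \<Rightarrow> nat \<Rightarrow> mpoly" where
  "indet i j = monomial (Poly_Mapping.single (i, j) 1)"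

abbreviation coefficient :: "mpoly \<Rightarrow> multiindex \<Rightarrow> rat" where
  "coefficient \<equiv> Poly_Mapping.lookup"

definition generic_mat :: "nat \<Rightarrow> mpoly mat" where
  "generic_mat n = mat n n (\<lambda>(i, j). indet i j)"

definition multiindices :: "nat \<Rightarrow> multiindex set" where
  "multiindices n = {\<alpha>. Poly_Mapping.keys \<alpha> \<subseteq> {..<n} \<times> {..<n}}"

definition mi_size :: "nat \<Rightarrow> multiindex \<Rightarrow> nat" where
  "mi_size n \<alpha> = (\<Sum>i<n. \<Sum>j<n. Poly_Mapping.lookup \<alpha> (i, j))"

definition mi_fact :: "nat \<Rightarrow> multiindex \<Rightarrow> nat" where
  "mi_fact n \<alpha> = (\<Prod>i<n. \<Prod>j<n. fact (Poly_Mapping.lookup \<alpha> (i, j)))"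

lemma lookup_outside:
  assumes "\<alpha> \<in> multiindices n" "x \<notin> {..<n} \<times> {..<n}"
  shows "Poly_Mapping.lookup \<alpha> x = 0"
proof -
  have "x \<notin> Poly_Mapping.keys \<alpha>"
    using assms unfolding multiindices_def by blast
  then show ?thesis
    by (rule contrapos_np) (simp only: in_keys_iff not_False_eq_True)
qed

text \<open>The set of multiindices of a given size is finite, so sums over it are genuine sums.\<close>

lemma finite_multiindices: "finite {\<alpha> \<in> multiindices n. mi_size n \<alpha> = d}"
proof -
  let ?I = "{..<n} \<times> {..<n}"
  let ?F = "{f :: nat \<times> nat \<Rightarrow> nat. \<forall>x. (x \<in> ?I \<longrightarrow> f x \<in> {..d}) \<and> (x \<notin> ?I \<longrightarrow> f x = 0)}"
  have "Poly_Mapping.lookup ` {\<alpha> \<in> multiindices n. mi_size n \<alpha> = d} \<subseteq> ?F"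
  proof (rule image_subsetI)
    fix \<alpha> assume a: "\<alpha> \<in> {\<alpha> \<in> multiindices n. mi_size n \<alpha> = d}"
    have "Poly_Mapping.lookup \<alpha> x \<le> d" if "x \<in> ?I" for x
    proof -
      have "Poly_Mapping.lookup \<alpha> x \<le> sum (Poly_Mapping.lookup \<alpha>) ?I"
        using that by (intro member_le_sum) auto
      also have "\<dots> = d"
        using a by (simp add: mi_size_def sum.cartesian_product)
      finally show ?thesis .
    qed
    moreover have "Poly_Mapping.lookup \<alpha> x = 0" if "x \<notin> ?I" for x
      using a that lookup_outside by blast
    ultimately show "Poly_Mapping.lookup \<alpha> \<in> ?F" by blast
  qed
  moreover have "finite ?F"
    by (rule finite_set_of_finite_funs) auto
  moreover have "inj_on Poly_Mapping.lookup {\<alpha> \<in> multiindices n. mi_size n \<alpha> = d}"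
    by (rule inj_onI, rule poly_mapping_eqI) simp
  ultimately show ?thesis
    by (meson finite_imageD finite_subset)
qed

lemma monomial_add: "monomial (\<alpha> + \<beta>) = monomial \<alpha> * monomial \<beta>"
  by (simp add: monomial_def mult_single)

lemma monomial_0 [simp]: "monomial 0 = 1"
  by (simp add: monomial_def)

lemma monomial_sum: "monomial (sum f A) = (\<Prod>x\<in>A. monomial (f x))"
  by (induction A rule: infinite_finite_induct) (simp_all add: monomial_add)

lemma indet_power: "indet i j ^ m = monomial (Poly_Mapping.single (i, j) m)"
proof (induction m)
  case (Suc m)
  have "indet i j ^ Suc m = monomial (Poly_Mapping.single (i, j) 1 + Poly_Mapping.single (i, j) m)"
    unfolding power_Suc Suc.IH monomial_add by (simp only: indet_def)
  also have "Poly_Mapping.single (i, j) 1 + Poly_Mapping.single (i, j) m =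
      Poly_Mapping.single (i, j) (Suc m)"
    unfolding single_add [symmetric] by simp
  finally show ?case .
qed simp

lemma monomial_eq_prod_indet:
  assumes "\<alpha> \<in> multiindices n"
  shows "monomial \<alpha> = (\<Prod>i<n. \<Prod>j<n. indet i j ^ Poly_Mapping.lookup \<alpha> (i, j))"
proof -
  let ?s = "\<lambda>(i, j). Poly_Mapping.single (i, j) (Poly_Mapping.lookup \<alpha> (i, j))"
  have "\<alpha> = (\<Sum>x\<in>{..<n} \<times> {..<n}. ?s x)"
  proof (rule poly_mapping_eqI)
    fix y
    have "Poly_Mapping.lookup (\<Sum>x\<in>{..<n} \<times> {..<n}. ?s x) y =
      (\<Sum>x\<in>{..<n} \<times> {..<n}. if x = y then Poly_Mapping.lookup \<alpha> y else 0)"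
      by (auto simp: lookup_sum lookup_single when_def intro!: sum.cong)
    also have "\<dots> = Poly_Mapping.lookup \<alpha> y"
      using lookup_outside [OF assms, of y]
      by (simp only: sum.delta finite_SigmaI finite_lessThan split: if_split) simp
    finally show "Poly_Mapping.lookup \<alpha> y = Poly_Mapping.lookup (\<Sum>x\<in>{..<n} \<times> {..<n}. ?s x) y" ..
  qed
  then have "monomial \<alpha> = (\<Prod>x\<in>{..<n} \<times> {..<n}. monomial (?s x))"
    by (rule trans [OF arg_cong [of _ _ monomial] monomial_sum])
  then show ?thesis
    by (simp add: indet_power prod.cartesian_product case_prod_beta)
qed

end

theory Submission
  imports Defs
begin

text \<open>
  The sum is the Fischer norm of \<open>det\<^sup>k\<close>, for the pairing that makes multiplication by \<open>X\<^sub>i\<^sub>j\<close>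
  adjoint to \<open>\<partial>/\<partial>X\<^sub>i\<^sub>j\<close>. Hence multiplication by \<open>det\<close> is adjoint to the Cayley operator
  \<open>det(\<partial>)\<close>, and the Cayley identity
  \<open>det(\<partial>) det\<^sup>s\<^sup>+\<^sup>1 = (s+1)(s+2)\<dots>(s+n) det\<^sup>s\<close> gives the norm by induction on \<open>k\<close>.
  The Cayley identity itself is obtained by applying the derivatives of one row at a time. After
  \<open>m\<close> rows, the antisymmetrised result is a multiple of \<open>det\<^sup>s E\<^sub>m(\<sigma>)\<close>, where \<open>E\<^sub>m(\<sigma>)\<close> is the
  determinant with rows \<open>i < m\<close> replaced by the unit vectors \<open>e\<^bsub>\<sigma>(i)\<^esub>\<close>; the product-rule term in which
  \<open>det\<^sup>s\<close> is differentiated is reduced to the other one by a Pluecker exchange relation, which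
  is Cramer's rule and requires no division by \<open>det\<close>.
\<close>

section \<open>Partial derivatives and the Fischer pairing\<close>

text \<open>Reduces an additive claim to single monomials; the product rule and adjointness below
  are both proved this way.\<close>

lemma poly_mapping_sum_induct [case_names single add]:
  fixes p :: "'k \<Rightarrow>\<^sub>0 'a::comm_monoid_add"
  assumes single: "\<And>k a. P (Poly_Mapping.single k a)"
    and add: "\<And>p q. P p \<Longrightarrow> P q \<Longrightarrow> P (p + q)"
  shows "P p"
proof (induction p rule: update_induct)
  case const
  show ?case using single [of undefined 0] by simp
next
  case (update f k a)
  have "Poly_Mapping.update k a f = f + Poly_Mapping.single k a"
    using update by (intro poly_mapping_eqI)
      (auto simp: lookup_update lookup_add lookup_single in_keys_iff)
  then show ?case using update single add by simp
qed

text \<open>Working on coefficients makes additivity immediate, and the factor \<alpha>(x) + 1 is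
  the one by which \<alpha>! grows when the exponent of \<open>x\<close> is raised by one.\<close>

lift_definition pderiv_mp ::
    "'x \<Rightarrow> (('x \<Rightarrow>\<^sub>0 nat) \<Rightarrow>\<^sub>0 'a::comm_semiring_1) \<Rightarrow> (('x \<Rightarrow>\<^sub>0 nat) \<Rightarrow>\<^sub>0 'a)"
  is "\<lambda>x p \<alpha>. of_nat (Suc (Poly_Mapping.lookup \<alpha> x)) * p (\<alpha> + Poly_Mapping.single x 1)"
proof -
  fix x :: 'x and p :: "('x \<Rightarrow>\<^sub>0 nat) \<Rightarrow> 'a"
  assume "finite {\<alpha>. p \<alpha> \<noteq> 0}"
  then have "finite ((\<lambda>\<alpha>. \<alpha> + Poly_Mapping.single x 1) -` {\<alpha>. p \<alpha> \<noteq> 0})"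
    by (rule finite_vimageI) (simp add: inj_on_def)
  then show "finite {\<alpha>. of_nat (Suc (Poly_Mapping.lookup \<alpha> x)) *
      p (\<alpha> + Poly_Mapping.single x 1) \<noteq> 0}"
    by (rule rev_finite_subset) auto
qed

lemma pderiv_mp_add: "pderiv_mp x (p + q) = pderiv_mp x p + pderiv_mp x q"
  by (intro poly_mapping_eqI) (simp add: pderiv_mp.rep_eq lookup_add algebra_simps)

lemma pderiv_mp_0 [simp]: "pderiv_mp x 0 = 0"
  by (intro poly_mapping_eqI) (simp add: pderiv_mp.rep_eq)

lemma pderiv_mp_sum: "pderiv_mp x (sum f A) = (\<Sum>a\<in>A. pderiv_mp x (f a))"
  by (induction A rule: infinite_finite_induct) (simp_all add: pderiv_mp_add)

text \<open>Subtraction of exponents is truncated: if \<open>x\<close> does not occur, the exponent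
  stays \<alpha>, but then the coefficient is 0.\<close>

lemma pderiv_mp_single:
  "pderiv_mp x (Poly_Mapping.single \<alpha> a) =
    Poly_Mapping.single (\<alpha> - Poly_Mapping.single x 1) (of_nat (Poly_Mapping.lookup \<alpha> x) * a)"
proof (cases "Poly_Mapping.lookup \<alpha> x = 0")
  case True
  then have "\<alpha> \<noteq> \<beta> + Poly_Mapping.single x 1" for \<beta>
    by (auto simp: lookup_add)
  with True show ?thesis
    by (intro poly_mapping_eqI) (simp add: pderiv_mp.rep_eq lookup_single)
next
  case False
  have eq: "\<alpha> = \<alpha> - Poly_Mapping.single x 1 + Poly_Mapping.single x 1"
    using False by (intro poly_mapping_eqI)
      (auto simp: lookup_add lookup_minus lookup_single when_def)
  have "\<alpha> = \<beta> + Poly_Mapping.single x 1 \<longleftrightarrow> \<alpha> - Poly_Mapping.single x 1 = \<beta>" for \<beta>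
    by (subst eq) (simp only: add_right_cancel)
  moreover obtain m where "Poly_Mapping.lookup \<alpha> x = Suc m"
    using False not0_implies_Suc by blast
  ultimately show ?thesis
    by (intro poly_mapping_eqI)
      (auto simp: pderiv_mp.rep_eq lookup_single when_def lookup_minus)
qed

lemma pderiv_mp_1 [simp]: "pderiv_mp x 1 = 0"
  using pderiv_mp_single [of x 0 1] by simp

lemma pderiv_mp_mult: "pderiv_mp x (p * q) = pderiv_mp x p * q + p * pderiv_mp x q"
proof (induction p rule: poly_mapping_sum_induct)
  case (single \<alpha> a)
  show ?case
  proof (induction q rule: poly_mapping_sum_induct)
    case (single \<beta> b)
    let ?e = "Poly_Mapping.single x (1::nat)"
    \<comment> \<open>Truncated subtraction moves past the addition when \<open>x\<close> occurs in
      \<gamma>; if it does not, the corresponding term of the product rule has coefficient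
      0.\<close>
    have shift: "\<gamma> + \<delta> - ?e = (\<gamma> - ?e) + \<delta>" if "Poly_Mapping.lookup \<gamma> x > 0" for \<gamma> \<delta>
      using that by (intro poly_mapping_eqI)
        (auto simp: lookup_add lookup_minus lookup_single when_def)
    have 1: "Poly_Mapping.single (\<alpha> + \<beta> - ?e) (of_nat (Poly_Mapping.lookup \<alpha> x) * (a * b)) =
        Poly_Mapping.single (\<alpha> - ?e + \<beta>) (of_nat (Poly_Mapping.lookup \<alpha> x) * a * b)"
      using shift [of \<alpha> \<beta>] by (cases "Poly_Mapping.lookup \<alpha> x") (simp_all add: mult.assoc)
    have 2: "Poly_Mapping.single (\<alpha> + \<beta> - ?e) (of_nat (Poly_Mapping.lookup \<beta> x) * (a * b)) =
        Poly_Mapping.single (\<alpha> + (\<beta> - ?e)) (a * (of_nat (Poly_Mapping.lookup \<beta> x) * b))"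
      using shift [of \<beta> \<alpha>] by (cases "Poly_Mapping.lookup \<beta> x") (simp_all add: ac_simps)
    show ?case
      unfolding mult_single pderiv_mp_single lookup_add of_nat_add distrib_right single_add 1 2 ..
  next
    case (add p q)
    then show ?case by (simp add: pderiv_mp_add algebra_simps)
  qed
next
  case (add p q)
  then show ?case by (simp add: pderiv_mp_add algebra_simps)
qed

lemma pderiv_mp_uminus:
  fixes p :: "('x \<Rightarrow>\<^sub>0 nat) \<Rightarrow>\<^sub>0 'a::comm_ring_1"
  shows "pderiv_mp x (- p) = - pderiv_mp x p"
  by (intro poly_mapping_eqI) (simp add: pderiv_mp.rep_eq)

lemma pderiv_mp_power_Suc:
  "pderiv_mp x (p ^ Suc s) = of_nat (Suc s) * p ^ s * pderiv_mp x p"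
  by (induction s) (simp_all add: pderiv_mp_mult algebra_simps)

lemma pderiv_mp_prod_eq_0:
  assumes "\<And>a. a \<in> A \<Longrightarrow> pderiv_mp x (f a) = 0"
  shows "pderiv_mp x (prod f A) = 0"
  using assms by (induction A rule: infinite_finite_induct) (simp_all add: pderiv_mp_mult)

lemma pderiv_mp_signof [simp]:
  "pderiv_mp x (signof \<sigma> :: ('x \<Rightarrow>\<^sub>0 nat) \<Rightarrow>\<^sub>0 'a::comm_ring_1) = 0"
  using signof_pm_one [of \<sigma>] by (auto simp: sign_def pderiv_mp_uminus)

lemma pderiv_mp_indet:
  "pderiv_mp (i, j) (indet r c) = (if r = i \<and> c = j then 1 else 0)"
  by (auto simp: indet_def monomial_def pderiv_mp_single lookup_single when_def)

section \<open>Factorial weights and the bilinear pairing\<close>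

definition fact_mp :: "('x \<Rightarrow>\<^sub>0 nat) \<Rightarrow> nat" where
  "fact_mp \<alpha> = (\<Prod>x\<in>Poly_Mapping.keys \<alpha>. fact (Poly_Mapping.lookup \<alpha> x))"

lemma fact_mp_superset:
  assumes "finite A" "Poly_Mapping.keys \<alpha> \<subseteq> A"
  shows "fact_mp \<alpha> = (\<Prod>x\<in>A. fact (Poly_Mapping.lookup \<alpha> x))"
  unfolding fact_mp_def using assms
  by (intro prod.mono_neutral_left) (auto simp: in_keys_iff)

lemma fact_mp_add_single:
  "fact_mp (\<alpha> + Poly_Mapping.single x 1) = Suc (Poly_Mapping.lookup \<alpha> x) * fact_mp \<alpha>"
proof -
  let ?A = "insert x (Poly_Mapping.keys \<alpha>)"
  have "fact_mp (\<alpha> + Poly_Mapping.single x 1) =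
      (\<Prod>y\<in>?A. fact (Poly_Mapping.lookup (\<alpha> + Poly_Mapping.single x 1) y))"
    by (rule fact_mp_superset) (auto simp: in_keys_iff lookup_add lookup_single when_def split: if_splits)
  also have "\<dots> = fact (Suc (Poly_Mapping.lookup \<alpha> x)) *
      (\<Prod>y\<in>?A - {x}. fact (Poly_Mapping.lookup \<alpha> y))"
    by (subst prod.remove [of _ x]) (auto simp: lookup_add lookup_single when_def intro!: prod.cong split: if_splits)
  also have "\<dots> = Suc (Poly_Mapping.lookup \<alpha> x) * (\<Prod>y\<in>?A. fact (Poly_Mapping.lookup \<alpha> y))"
    by (subst (2) prod.remove [of _ x]) (auto simp: algebra_simps)
  also have "(\<Prod>y\<in>?A. fact (Poly_Mapping.lookup \<alpha> y)) = fact_mp \<alpha>"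
    by (rule fact_mp_superset [symmetric]) auto
  finally show ?thesis .
qed

text \<open>Also called the apolar form: distinct monomials are orthogonal and X^\<alpha> pairs with
  itself to \<alpha>!. The support of \<open>p\<close> suffices as range, since all other terms
  vanish.\<close>

definition fischer ::
    "(('x \<Rightarrow>\<^sub>0 nat) \<Rightarrow>\<^sub>0 'a::comm_ring_1) \<Rightarrow> (('x \<Rightarrow>\<^sub>0 nat) \<Rightarrow>\<^sub>0 'a) \<Rightarrow> 'a" where
  "fischer p q = (\<Sum>\<alpha>\<in>Poly_Mapping.keys p.
    Poly_Mapping.lookup p \<alpha> * Poly_Mapping.lookup q \<alpha> * of_nat (fact_mp \<alpha>))"

lemma fischer_superset:
  assumes "finite A" "Poly_Mapping.keys p \<subseteq> A"
  shows "fischer p q =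
    (\<Sum>\<alpha>\<in>A. Poly_Mapping.lookup p \<alpha> * Poly_Mapping.lookup q \<alpha> * of_nat (fact_mp \<alpha>))"
  unfolding fischer_def using assms
  by (intro sum.mono_neutral_left) (auto simp: in_keys_iff)

lemma fischer_add_left: "fischer (p + q) r = fischer p r + fischer q r"
proof -
  let ?A = "Poly_Mapping.keys p \<union> Poly_Mapping.keys q"
  have "fischer (p + q) r = (\<Sum>\<alpha>\<in>?A. Poly_Mapping.lookup (p + q) \<alpha> *
      Poly_Mapping.lookup r \<alpha> * of_nat (fact_mp \<alpha>))"
    by (rule fischer_superset) (simp_all add: keys_add)
  also have "\<dots> = fischer p r + fischer q r"
    by (simp add: fischer_superset [of ?A] lookup_add distrib_right sum.distrib)
  finally show ?thesis .
qed

lemma fischer_add_right: "fischer p (q + r) = fischer p q + fischer p r"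
  by (simp add: fischer_def lookup_add distrib_left distrib_right sum.distrib)

lemma fischer_0 [simp]: "fischer 0 q = 0" "fischer p 0 = 0"
  by (simp_all add: fischer_def)

lemma fischer_uminus_left: "fischer (- p) q = - fischer p q"
  using fischer_add_left [of p "- p" q] by (simp add: eq_neg_iff_add_eq_0 add.commute)

lemma fischer_uminus_right: "fischer p (- q) = - fischer p q"
  using fischer_add_right [of p q "- q"] by (simp add: eq_neg_iff_add_eq_0 add.commute)

lemma fischer_sum_left: "fischer (sum f A) q = (\<Sum>a\<in>A. fischer (f a) q)"
  by (induction A rule: infinite_finite_induct) (simp_all add: fischer_add_left)

lemma fischer_sum_right: "fischer p (sum f A) = (\<Sum>a\<in>A. fischer p (f a))"
  by (induction A rule: infinite_finite_induct) (simp_all add: fischer_add_right)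

lemma fischer_of_nat_right: "fischer p (of_nat m * q) = of_nat m * fischer p q"
  by (induction m) (simp_all add: distrib_right fischer_add_right)

lemma fischer_signof_left: "fischer (signof \<sigma> * p) q = signof \<sigma> * fischer p q"
  by (simp add: sign_def fischer_uminus_left)

lemma fischer_signof_right: "fischer p (signof \<sigma> * q) = signof \<sigma> * fischer p q"
  by (simp add: sign_def fischer_uminus_right)

lemma fischer_1_1: "fischer 1 1 = 1"
  by (simp add: fischer_def fact_mp_def)

lemma fischer_single: "fischer (Poly_Mapping.single \<alpha> a) q =
    a * Poly_Mapping.lookup q \<alpha> * of_nat (fact_mp \<alpha>)"
  by (subst fischer_superset [of "{\<alpha>}"]) simp_all

text \<open>On a monomial this is (\<alpha> + e)! = (\<alpha>(i,j) + 1) \<alpha>!, where e is the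
  unit multiindex at (i,j); the new factor is the one built into \<open>pderiv_mp\<close>.\<close>

lemma fischer_indet_mult: "fischer (indet i j * p) q = fischer p (pderiv_mp (i, j) q)"
proof (induction p rule: poly_mapping_sum_induct)
  case (single \<alpha> a)
  have "indet i j * Poly_Mapping.single \<alpha> a =
      Poly_Mapping.single (\<alpha> + Poly_Mapping.single (i, j) 1) a"
    by (simp add: indet_def monomial_def mult_single add.commute)
  then show ?case
    by (simp add: fischer_single fact_mp_add_single [simplified] pderiv_mp.rep_eq algebra_simps)
next
  case (add p q)
  then show ?case by (simp add: distrib_left fischer_add_left)
qed

section \<open>Determinants as functions of their rows\<close>

text \<open>With rows given by a function, replacing a row is \<open>f(k := v)\<close> and permuting
  rows is \<open>f \<circ> \<sigma>\<close>.\<close>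

definition row_det :: "nat \<Rightarrow> (nat \<Rightarrow> nat \<Rightarrow> 'a::comm_ring_1) \<Rightarrow> 'a" where
  "row_det n f = det (mat n n (\<lambda>(i, j). f i j))"

lemma row_det_cong:
  assumes "\<And>i j. i < n \<Longrightarrow> j < n \<Longrightarrow> f i j = g i j"
  shows "row_det n f = row_det n g"
  unfolding row_det_def using assms by (intro arg_cong [of _ _ det] eq_matI) auto

lemma row_det_leibniz:
  "row_det n f = (\<Sum>\<sigma> | \<sigma> permutes {0..<n}. signof \<sigma> * (\<Prod>i = 0..<n. f i (\<sigma> i)))"
proof -
  have "row_det n f = (\<Sum>\<sigma> | \<sigma> permutes {0..<n}.
      signof \<sigma> * (\<Prod>i = 0..<n. mat n n (\<lambda>(i, j). f i j) $$ (i, \<sigma> i)))"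
    unfolding row_det_def by (rule det_def') simp
  also have "\<dots> = (\<Sum>\<sigma> | \<sigma> permutes {0..<n}. signof \<sigma> * (\<Prod>i = 0..<n. f i (\<sigma> i)))"
  proof (intro sum.cong refl arg_cong2 [of _ _ _ _ times] prod.cong)
    fix \<sigma> i assume "\<sigma> \<in> {\<sigma>. \<sigma> permutes {0..<n}}" "i \<in> {0..<n}"
    then have "\<sigma> i < n" using permutes_in_image [of \<sigma> "{0..<n}" i] by auto
    with \<open>i \<in> {0..<n}\<close> show "mat n n (\<lambda>(i, j). f i j) $$ (i, \<sigma> i) = f i (\<sigma> i)" by simp
  qed
  finally show ?thesis .
qed

lemma row_det_permute:
  assumes "\<sigma> permutes {0..<n}"
  shows "row_det n (f \<circ> \<sigma>) = signof \<sigma> * row_det n f"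
proof -
  let ?A = "mat n n (\<lambda>(i, j). f i j)"
  have "row_det n (f \<circ> \<sigma>) = det (mat n n (\<lambda>(i, j). ?A $$ (\<sigma> i, j)))"
    unfolding row_det_def using permutes_in_image [OF assms]
    by (intro arg_cong [of _ _ det] eq_matI) auto
  also have "\<dots> = signof \<sigma> * det ?A"
    by (rule det_permute_rows [OF _ assms]) simp
  finally show ?thesis by (simp add: row_det_def)
qed

lemma row_det_identical_rows:
  assumes "i < n" "j < n" "i \<noteq> j" "f i = f j"
  shows "row_det n f = 0"
  unfolding row_det_def
  by (rule det_identical_rows [of _ n i j]) (use assms in \<open>auto intro!: eq_vecI\<close>)

definition unit_row :: "nat \<Rightarrow> nat \<Rightarrow> 'a::comm_ring_1" where
  "unit_row j c = (if c = j then 1 else 0)"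

lemma row_det_unit_row:
  assumes "\<sigma> permutes {0..<n}"
  shows "row_det n (\<lambda>i. unit_row (\<sigma> i)) = (signof \<sigma> :: 'a::comm_ring_1)"
proof -
  have "mat n n (\<lambda>(i, j). unit_row i j) = (1\<^sub>m n :: 'a mat)"
    by (intro eq_matI) (auto simp: unit_row_def)
  then have "row_det n unit_row = (1 :: 'a)"
    by (simp add: row_det_def)
  then show ?thesis
    using row_det_permute [OF assms, of "unit_row :: nat \<Rightarrow> nat \<Rightarrow> 'a"] by (simp add: comp_def)
qed

section \<open>Cramer's rule, the exchange relation and row-wise differentiation\<close>

lemma row_det_expand:
  assumes "r < n"
  shows "row_det n (f(r := v)) = (\<Sum>c<n. v c * cofactor (mat n n (\<lambda>(i, j). f i j)) r c)"
proof -
  \<comment> \<open>Cofactors along row \<open>r\<close> delete that row, so they do not see the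
    replacement by \<open>v\<close>; the result is a linear form in \<open>v\<close>.\<close>
  have "mat_delete (mat n n (\<lambda>(i, j). (f(r := v)) i j)) r c = mat_delete (mat n n (\<lambda>(i, j). f i j)) r c" for c
    unfolding mat_delete_def using assms by (intro eq_matI) auto
  then have "cofactor (mat n n (\<lambda>(i, j). (f(r := v)) i j)) r c =
      cofactor (mat n n (\<lambda>(i, j). f i j)) r c" for c
    by (simp add: cofactor_def)
  then show ?thesis
    unfolding row_det_def using assms by (subst laplace_expansion_row [of _ n r]) (simp_all del: fun_upd_apply add: fun_upd_same)
qed

text \<open>The numbers \<open>row_det n (f(r := v))\<close> are the entries of v adj(A), and adj(A)
  A is det(A) times the identity.\<close>

lemma row_det_cramer:
  assumes "d < n"
  shows "(\<Sum>r<n. f r d * row_det n (f(r := v))) = v d * row_det n f"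
proof -
  let ?A = "mat n n (\<lambda>(i, j). f i j)"
  have A: "?A \<in> carrier_mat n n" by simp
  have adj: "(\<Sum>r<n. cofactor ?A r c * f r d) = (if c = d then row_det n f else 0)" if "c < n" for c
  proof -
    have "(\<Sum>r<n. cofactor ?A r c * f r d) = (adj_mat ?A * ?A) $$ (c, d)"
      using that assms adj_mat(1) [OF A]
      by (auto simp: scalar_prod_def adj_mat_def atLeast0LessThan intro!: sum.cong)
    also have "\<dots> = (if c = d then row_det n f else 0)"
      using that assms by (simp add: adj_mat(3) [OF A] row_det_def)
    finally show ?thesis .
  qed
  have "(\<Sum>r<n. f r d * row_det n (f(r := v))) = (\<Sum>r<n. \<Sum>c<n. v c * (cofactor ?A r c * f r d))"
    by (intro sum.cong) (auto simp: row_det_expand sum_distrib_left ac_simps)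
  also have "\<dots> = (\<Sum>c<n. v c * (\<Sum>r<n. cofactor ?A r c * f r d))"
    by (subst sum.swap) (simp add: sum_distrib_left)
  also have "\<dots> = (\<Sum>c<n. if c = d then v c * row_det n f else 0)"
    by (intro sum.cong) (auto simp: adj)
  also have "\<dots> = v d * row_det n f"
    using assms by simp
  finally show ?thesis .
qed

text \<open>Cramer's rule writes det(f) v as a combination of the rows of \<open>f\<close>; the
  linear form sending w to \<open>row_det n (g(k := w))\<close> is applied to both sides.\<close>

lemma row_det_exchange:
  assumes "k < n"
  shows "(\<Sum>r<n. row_det n (g(k := f r)) * row_det n (f(r := v))) =
    row_det n (g(k := v)) * row_det n f"
proof -
  let ?C = "\<lambda>c. cofactor (mat n n (\<lambda>(i, j). g i j)) k c"
  have "(\<Sum>r<n. row_det n (g(k := f r)) * row_det n (f(r := v))) =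
      (\<Sum>r<n. \<Sum>c<n. ?C c * (f r c * row_det n (f(r := v))))"
    using assms by (intro sum.cong) (auto simp: row_det_expand [of k] sum_distrib_left sum_distrib_right ac_simps)
  also have "\<dots> = (\<Sum>c<n. ?C c * (\<Sum>r<n. f r c * row_det n (f(r := v))))"
    by (subst sum.swap) (simp add: sum_distrib_left)
  also have "\<dots> = (\<Sum>c<n. ?C c * (v c * row_det n f))"
    by (intro sum.cong) (auto simp: row_det_cramer)
  also have "\<dots> = row_det n (g(k := v)) * row_det n f"
    using assms by (simp add: row_det_expand sum_distrib_left sum_distrib_right ac_simps)
  finally show ?thesis .
qed

text \<open>Each Leibniz product has exactly one factor from row \<open>k\<close>, and only that
  factor can have a nonzero derivative.\<close>

lemma pderiv_mp_row_det:
  assumes "k < n" "\<And>r c. r < n \<Longrightarrow> c < n \<Longrightarrow> r \<noteq> k \<Longrightarrow> pderiv_mp x (f r c) = 0"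
  shows "pderiv_mp x (row_det n f) = row_det n (f(k := \<lambda>c. pderiv_mp x (f k c)))"
proof -
  have "pderiv_mp x (\<Prod>i = 0..<n. f i (\<sigma> i)) =
      (\<Prod>i = 0..<n. (f(k := \<lambda>c. pderiv_mp x (f k c))) i (\<sigma> i))"
    if "\<sigma> permutes {0..<n}" for \<sigma>
  proof -
    have "pderiv_mp x (\<Prod>i\<in>{0..<n} - {k}. f i (\<sigma> i)) = 0"
      using permutes_in_image [OF that] by (intro pderiv_mp_prod_eq_0 assms(2)) auto
    moreover have "(\<Prod>i\<in>{0..<n} - {k}. (f(k := \<lambda>c. pderiv_mp x (f k c))) i (\<sigma> i)) =
        (\<Prod>i\<in>{0..<n} - {k}. f i (\<sigma> i))"
      by (intro prod.cong) auto
    ultimately show ?thesis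
      using assms(1) by (simp add: prod.remove [of "{0..<n}" k] pderiv_mp_mult)
  qed
  then show ?thesis
    by (simp add: row_det_leibniz pderiv_mp_sum pderiv_mp_mult)
qed


section \<open>The Cayley identity in adjoint form\<close>

text \<open>The rows of E_m(\<sigma>). Its determinant passes from the generic one at m = 0 to the
  sign of \<sigma> at m = n.\<close>

definition partial_rows :: "nat \<Rightarrow> (nat \<Rightarrow> nat) \<Rightarrow> nat \<Rightarrow> nat \<Rightarrow> mpoly" where
  "partial_rows m \<sigma> i = (if i < m then unit_row (\<sigma> i) else indet i)"

text \<open>
  The pairing of \<open>p\<close> with what remains of the Cayley operator applied to \<open>F\<close>, when the
  derivatives \<open>\<partial>/\<partial>X\<^bsub>i,\<sigma>(i)\<^esub>\<close> with \<open>i < m\<close> have already been carried out.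
\<close>

definition skew_sum ::
    "nat \<Rightarrow> mpoly \<Rightarrow> nat \<Rightarrow> ((nat \<Rightarrow> nat) \<Rightarrow> mpoly) \<Rightarrow> rat" where
  "skew_sum n p m F = (\<Sum>\<sigma> | \<sigma> permutes {0..<n}.
     signof \<sigma> * fischer (p * (\<Prod>i = m..<n. indet i (\<sigma> i))) (F \<sigma>))"

lemma skew_sum_cong:
  assumes "\<And>\<sigma>. \<sigma> permutes {0..<n} \<Longrightarrow> F \<sigma> = G \<sigma>"
  shows "skew_sum n p m F = skew_sum n p m G"
  unfolding skew_sum_def using assms by (intro sum.cong) auto

lemma skew_sum_add: "skew_sum n p m (\<lambda>\<sigma>. F \<sigma> + G \<sigma>) = skew_sum n p m F + skew_sum n p m G"
  by (simp add: skew_sum_def fischer_add_right distrib_left sum.distrib)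

lemma skew_sum_sum: "skew_sum n p m (\<lambda>\<sigma>. \<Sum>a\<in>A. F a \<sigma>) = (\<Sum>a\<in>A. skew_sum n p m (F a))"
  unfolding skew_sum_def by (subst sum.swap) (simp add: fischer_sum_right sum_distrib_left)

lemma skew_sum_of_nat: "skew_sum n p m (\<lambda>\<sigma>. of_nat c * F \<sigma>) = of_nat c * skew_sum n p m F"
  by (simp only: skew_sum_def mult.left_commute fischer_of_nat_right sum_distrib_left)

text \<open>Adjointness carries the factor X_(m,\<sigma>(m)) across the pairing, where it becomes a
  derivative.\<close>

lemma skew_sum_step:
  assumes "m < n"
  shows "skew_sum n p m F = skew_sum n p (Suc m) (\<lambda>\<sigma>. pderiv_mp (m, \<sigma> m) (F \<sigma>))"
proof -
  have "p * (\<Prod>i = m..<n. indet i (\<sigma> i)) =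
      indet m (\<sigma> m) * (p * (\<Prod>i = Suc m..<n. indet i (\<sigma> i)))" for \<sigma>
    using assms by (simp add: prod.atLeast_Suc_lessThan ac_simps)
  then show ?thesis
    by (simp add: skew_sum_def fischer_indet_mult)
qed

text \<open>Swapping the values of \<sigma> at two positions below \<open>m\<close> leaves the
  remaining product of indeterminates unchanged and flips the sign.\<close>

lemma skew_sum_transpose:
  assumes "a < m" "b < m" "a \<noteq> b" "m \<le> n"
  shows "skew_sum n p m (\<lambda>\<sigma>. F (\<sigma> \<circ> transpose a b)) = - skew_sum n p m F"
proof -
  let ?t = "transpose a b"
  have t: "?t permutes {0..<n}"
    using assms by (intro permutes_swap_id) auto
  have "skew_sum n p m F = (\<Sum>\<sigma> | \<sigma> permutes {0..<n}. signof (\<sigma> \<circ> ?t) *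
      fischer (p * (\<Prod>i = m..<n. indet i ((\<sigma> \<circ> ?t) i))) (F (\<sigma> \<circ> ?t)))"
    unfolding skew_sum_def by (rule sum_permutations_compose_right [OF t])
  also have "\<dots> = (\<Sum>\<sigma> | \<sigma> permutes {0..<n}. - (signof \<sigma> *
      fischer (p * (\<Prod>i = m..<n. indet i (\<sigma> i))) (F (\<sigma> \<circ> ?t))))"
  proof (intro sum.cong refl)
    fix \<sigma> assume "\<sigma> \<in> {\<sigma>. \<sigma> permutes {0..<n}}"
    then have "signof (\<sigma> \<circ> ?t) = (- signof \<sigma> :: rat)"
      using signof_compose [OF _ t, of \<sigma>] assms by (simp add: sign_swap_id)
    moreover have "(\<Prod>i = m..<n. indet i ((\<sigma> \<circ> ?t) i)) = (\<Prod>i = m..<n. indet i (\<sigma> i))"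
      using assms by (intro prod.cong) (auto simp: transpose_def)
    ultimately show "signof (\<sigma> \<circ> ?t) *
        fischer (p * (\<Prod>i = m..<n. indet i ((\<sigma> \<circ> ?t) i))) (F (\<sigma> \<circ> ?t)) =
        - (signof \<sigma> * fischer (p * (\<Prod>i = m..<n. indet i (\<sigma> i))) (F (\<sigma> \<circ> ?t)))"
      by simp
  qed
  also have "\<dots> = - skew_sum n p m (\<lambda>\<sigma>. F (\<sigma> \<circ> ?t))"
    by (simp add: skew_sum_def sum_negf)
  finally show ?thesis by simp
qed

section \<open>Differentiating along one row: product rule and exchange\<close>

lemma pderiv_mp_indet_row: "(\<lambda>c. pderiv_mp (i, j) (indet i c)) = unit_row j"
  by (auto simp: pderiv_mp_indet unit_row_def)

lemma pderiv_mp_generic_det: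
  assumes "m < n"
  shows "pderiv_mp (m, j) (row_det n indet) = row_det n (indet(m := unit_row j))"
proof -
  have "pderiv_mp (m, j) (row_det n indet) =
      row_det n (indet(m := \<lambda>c. pderiv_mp (m, j) (indet m c)))"
    by (rule pderiv_mp_row_det) (use assms in \<open>auto simp: pderiv_mp_indet\<close>)
  then show ?thesis by (simp only: pderiv_mp_indet_row)
qed

lemma pderiv_mp_partial_det:
  assumes "m < n"
  shows "pderiv_mp (m, \<sigma> m) (row_det n (partial_rows m \<sigma>)) = row_det n (partial_rows (Suc m) \<sigma>)"
proof -
  have "(partial_rows m \<sigma>)(m := \<lambda>c. pderiv_mp (m, \<sigma> m) (partial_rows m \<sigma> m c)) =
      partial_rows (Suc m) \<sigma>"
    by (rule ext) (auto simp: partial_rows_def pderiv_mp_indet_row)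
  then show ?thesis
    using assms by (subst pderiv_mp_row_det [of m])
      (auto simp: partial_rows_def pderiv_mp_indet unit_row_def)
qed

text \<open>For r = m this is the derivative of det times E_m(\<sigma>), because restoring row
  \<open>m\<close> of \<open>partial_rows (Suc m) \<sigma>\<close> gives
  \<open>partial_rows m \<sigma>\<close>. The cases r < m are its companions in the exchange
  relation.\<close>

definition exchange_term :: "nat \<Rightarrow> nat \<Rightarrow> nat \<Rightarrow> (nat \<Rightarrow> nat) \<Rightarrow> mpoly" where
  "exchange_term n m r \<sigma> = row_det n (indet(m := unit_row (\<sigma> r))) *
     row_det n ((partial_rows (Suc m) \<sigma>)(r := indet m))"

lemma sum_exchange_term:
  assumes "m < n"
  shows "(\<Sum>r<Suc m. exchange_term n m r \<sigma>) =
    row_det n indet * row_det n (partial_rows (Suc m) \<sigma>)"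
proof -
  let ?B = "partial_rows (Suc m) \<sigma>"
  let ?T = "\<lambda>r. row_det n (indet(m := ?B r)) * row_det n (?B(r := indet m))"
  have "(\<Sum>r<Suc m. exchange_term n m r \<sigma>) = (\<Sum>r<Suc m. ?T r)"
    by (intro sum.cong) (auto simp: exchange_term_def partial_rows_def)
  also have "\<dots> = (\<Sum>r<n. ?T r)"
  proof (intro sum.mono_neutral_left ballI)
    \<comment> \<open>For r > m the inserted row is \<open>indet r\<close>, which the generic matrix
      already has in position \<open>r\<close>.\<close>
    fix r assume "r \<in> {..<n} - {..<Suc m}"
    then have "row_det n (indet(m := ?B r)) = 0"
      by (intro row_det_identical_rows [of m n r]) (auto simp: partial_rows_def)
    then show "?T r = 0" by simp
  qed (use assms in auto)
  also have "\<dots> = row_det n (indet(m := indet m)) * row_det n ?B"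
    by (rule row_det_exchange [OF assms])
  finally show ?thesis by simp
qed

lemma exchange_term_transpose:
  assumes "r < m" "m < n"
  shows "exchange_term n m m (\<sigma> \<circ> transpose r m) = - exchange_term n m r \<sigma>"
proof -
  let ?t = "transpose r m"
  have t: "?t permutes {0..<n}"
    using assms by (intro permutes_swap_id) auto
  \<comment> \<open>The first factors agree since \<sigma> composed with the swap sends
    \<open>m\<close> to \<sigma>(r); the second ones differ by exchanging rows \<open>r\<close> and
    \<open>m\<close>.\<close>
  have "(partial_rows (Suc m) (\<sigma> \<circ> ?t))(m := indet m) =
      ((partial_rows (Suc m) \<sigma>)(r := indet m)) \<circ> ?t"
    using assms by (intro ext) (auto simp: partial_rows_def transpose_def)
  then have "row_det n ((partial_rows (Suc m) (\<sigma> \<circ> ?t))(m := indet m)) =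
      - row_det n ((partial_rows (Suc m) \<sigma>)(r := indet m))"
    using row_det_permute [OF t] assms by (simp add: sign_swap_id)
  then show ?thesis by (simp add: exchange_term_def)
qed

text \<open>The sign from swapping rows cancels the sign from reindexing \<sigma>, so all m + 1
  terms of the exchange relation contribute equally.\<close>

lemma skew_sum_exchange:
  assumes "m < n"
  shows "skew_sum n p (Suc m) (\<lambda>\<sigma>. q * (row_det n indet * row_det n (partial_rows (Suc m) \<sigma>))) =
    of_nat (Suc m) * skew_sum n p (Suc m) (\<lambda>\<sigma>. q * exchange_term n m m \<sigma>)"
proof -
  have eq: "skew_sum n p (Suc m) (\<lambda>\<sigma>. q * exchange_term n m r \<sigma>) =
      skew_sum n p (Suc m) (\<lambda>\<sigma>. q * exchange_term n m m \<sigma>)" if "r < Suc m" for r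
  proof (cases "r = m")
    case False
    with that have "r < m" by simp
    have "skew_sum n p (Suc m) (\<lambda>\<sigma>. q * exchange_term n m m \<sigma>) =
        - skew_sum n p (Suc m) (\<lambda>\<sigma>. q * exchange_term n m m (\<sigma> \<circ> transpose r m))"
      using skew_sum_transpose [of r "Suc m" m n p "\<lambda>\<sigma>. q * exchange_term n m m \<sigma>"]
        \<open>r < m\<close> assms by simp
    also have "\<dots> = skew_sum n p (Suc m) (\<lambda>\<sigma>. q * exchange_term n m r \<sigma>)"
      using \<open>r < m\<close> assms
      by (simp add: exchange_term_transpose skew_sum_def fischer_uminus_right sum_negf)
    finally show ?thesis by simp
  qed simp
  have "skew_sum n p (Suc m)
      (\<lambda>\<sigma>. q * (row_det n indet * row_det n (partial_rows (Suc m) \<sigma>))) =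
      (\<Sum>r<Suc m. skew_sum n p (Suc m) (\<lambda>\<sigma>. q * exchange_term n m r \<sigma>))"
    by (simp only: sum_exchange_term [OF assms, symmetric] sum_distrib_left skew_sum_sum)
  also have "\<dots> = (\<Sum>r<Suc m. skew_sum n p (Suc m) (\<lambda>\<sigma>. q * exchange_term n m m \<sigma>))"
    by (intro sum.cong refl eq) simp
  finally show ?thesis by (simp only: sum_constant card_lessThan)
qed

text \<open>Differentiating E_m contributes 1 and differentiating det^s contributes s/(m+1),
  together (s+m+1)/(m+1); denominators are cleared.\<close>

lemma skew_sum_partial_det_step:
  assumes "m < n"
  shows "of_nat (Suc m) * skew_sum n p m (\<lambda>\<sigma>. row_det n indet ^ s * row_det n (partial_rows m \<sigma>)) =
    of_nat (s + Suc m) *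
      skew_sum n p (Suc m) (\<lambda>\<sigma>. row_det n indet ^ s * row_det n (partial_rows (Suc m) \<sigma>))"
proof -
  let ?D = "row_det n indet"
  let ?E = "\<lambda>m \<sigma>. row_det n (partial_rows m \<sigma>)"
  let ?S = "skew_sum n p (Suc m)"
  have step: "skew_sum n p m (\<lambda>\<sigma>. ?D ^ s * ?E m \<sigma>) =
      ?S (\<lambda>\<sigma>. pderiv_mp (m, \<sigma> m) (?D ^ s) * ?E m \<sigma>) + ?S (\<lambda>\<sigma>. ?D ^ s * ?E (Suc m) \<sigma>)"
    using assms by (simp add: skew_sum_step pderiv_mp_mult skew_sum_add pderiv_mp_partial_det)
  have "of_nat (Suc m) * ?S (\<lambda>\<sigma>. pderiv_mp (m, \<sigma> m) (?D ^ s) * ?E m \<sigma>) =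
      of_nat s * ?S (\<lambda>\<sigma>. ?D ^ s * ?E (Suc m) \<sigma>)"
  proof (cases s)
    case 0
    then show ?thesis by (simp add: skew_sum_def)
  next
    case (Suc t)
    have rows: "(partial_rows (Suc m) \<sigma>)(m := indet m) = partial_rows m \<sigma>" for \<sigma>
      by (rule ext) (auto simp: partial_rows_def)
    have "pderiv_mp (m, \<sigma> m) (?D ^ s) * ?E m \<sigma> = of_nat s * (?D ^ t * exchange_term n m m \<sigma>)" for \<sigma>
      unfolding Suc pderiv_mp_power_Suc pderiv_mp_generic_det [OF assms] exchange_term_def rows
      by (simp only: mult.assoc)
    then have "?S (\<lambda>\<sigma>. pderiv_mp (m, \<sigma> m) (?D ^ s) * ?E m \<sigma>) =
        of_nat s * ?S (\<lambda>\<sigma>. ?D ^ t * exchange_term n m m \<sigma>)"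
      by (simp only: skew_sum_of_nat)
    \<comment> \<open>The exchange gives back the factor \<open>?D\<close> that differentiating the
      power had removed.\<close>
    then have "of_nat (Suc m) * ?S (\<lambda>\<sigma>. pderiv_mp (m, \<sigma> m) (?D ^ s) * ?E m \<sigma>) =
        of_nat s * ?S (\<lambda>\<sigma>. ?D ^ t * (?D * ?E (Suc m) \<sigma>))"
      unfolding skew_sum_exchange [OF assms] by (simp only: mult.left_commute)
    then show ?thesis by (simp add: Suc ac_simps)
  qed
  then show ?thesis
    by (simp add: step distrib_left distrib_right)
qed

text \<open>The cleared denominators 1, ..., m of the single steps multiply to
  \<open>fact m\<close>.\<close>

lemma skew_sum_partial_det_iterate:
  assumes "m \<le> n"
  shows "fact m * skew_sum n p 0 (\<lambda>\<sigma>. row_det n indet ^ s * row_det n (partial_rows 0 \<sigma>)) =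
    (\<Prod>i<m. of_nat (s + Suc i)) *
      skew_sum n p m (\<lambda>\<sigma>. row_det n indet ^ s * row_det n (partial_rows m \<sigma>))"
  using assms
proof (induction m)
  case (Suc m)
  then have IH: "fact m * skew_sum n p 0 (\<lambda>\<sigma>. row_det n indet ^ s * row_det n (partial_rows 0 \<sigma>)) =
    (\<Prod>i<m. of_nat (s + Suc i)) *
      skew_sum n p m (\<lambda>\<sigma>. row_det n indet ^ s * row_det n (partial_rows m \<sigma>))" by simp
  have "m < n" using Suc by simp
  show ?case
    unfolding fact_Suc mult.assoc IH prod.lessThan_Suc
    by (subst mult.left_commute, subst skew_sum_partial_det_step [OF \<open>m < n\<close>]) simp
qed simp

text \<open>Cayley's identity paired with an arbitrary \<open>p\<close>: the Leibniz expansion of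
  the left factor is the skew sum at m = 0, and the iteration is run up to m = n.\<close>

lemma fischer_det_power:
  "fischer (p * row_det n indet) (row_det n indet ^ Suc s) =
    (\<Prod>i<n. of_nat (s + Suc i)) * fischer p (row_det n indet ^ s)"
proof -
  let ?D = "row_det n indet"
  have "partial_rows 0 \<sigma> = indet" for \<sigma>
    by (rule ext) (simp add: partial_rows_def)
  moreover have expand: "fischer (p * ?D) q =
      (\<Sum>\<sigma> | \<sigma> permutes {0..<n}. signof \<sigma> * fischer (p * (\<Prod>i = 0..<n. indet i (\<sigma> i))) q)" for q
    by (simp only: row_det_leibniz sum_distrib_left fischer_sum_left
        mult.left_commute [of p] fischer_signof_left)
  ultimately have first: "skew_sum n p 0 (\<lambda>\<sigma>. ?D ^ s * row_det n (partial_rows 0 \<sigma>)) =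
      fischer (p * ?D) (?D ^ Suc s)"
    by (simp add: skew_sum_def expand power_commutes)
  have "row_det n (partial_rows n \<sigma>) = signof \<sigma>" if "\<sigma> permutes {0..<n}" for \<sigma>
    unfolding row_det_unit_row [OF that, symmetric]
    by (rule row_det_cong) (simp add: partial_rows_def)
  then have "skew_sum n p n (\<lambda>\<sigma>. ?D ^ s * row_det n (partial_rows n \<sigma>)) =
      skew_sum n p n (\<lambda>\<sigma>. signof \<sigma> * ?D ^ s)"
    by (intro skew_sum_cong) (simp add: mult.commute)
  \<comment> \<open>The two signs cancel, so the n! summands coincide; this n! later cancels
    \<open>fact n\<close> from the iteration.\<close>
  also have "\<dots> = (\<Sum>\<sigma> | \<sigma> permutes {0..<n}. fischer p (?D ^ s))"
    unfolding skew_sum_def by (intro sum.cong) (auto simp: fischer_signof_right sign_def fischer_uminus_right)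
  also have "\<dots> = fact n * fischer p (?D ^ s)"
    by (simp add: card_permutations [OF refl])
  finally have last: "skew_sum n p n (\<lambda>\<sigma>. ?D ^ s * row_det n (partial_rows n \<sigma>)) =
      fact n * fischer p (?D ^ s)" .
  show ?thesis
    using skew_sum_partial_det_iterate [of n n p s] unfolding first last by simp
qed

lemma fischer_det_power_self:
  "fischer (row_det n indet ^ k) (row_det n indet ^ k) = (\<Prod>i<n. fact (k + i)) / (\<Prod>i<n. fact i)"
proof (induction k)
  case 0
  show ?case by (simp add: fischer_1_1)
next
  case (Suc k)
  have "fischer (row_det n indet ^ Suc k) (row_det n indet ^ Suc k) =
      (\<Prod>i<n. of_nat (k + Suc i)) * ((\<Prod>i<n. fact (k + i)) / (\<Prod>i<n. fact i))"
    using fischer_det_power [of "row_det n indet ^ k" n k] Suc by (simp add: power_commutes)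
  \<comment> \<open>Factor by factor, (k+1+i) (k+i)! = (k+1+i)!.\<close>
  also have "\<dots> = (\<Prod>i<n. fact (Suc k + i)) / (\<Prod>i<n. fact i)"
    by (simp add: prod.distrib [symmetric] algebra_simps)
  finally show ?case .
qed

section \<open>Homogeneity of powers of the determinant\<close>

text \<open>Bounds the occurring variables as well as the degree, so that the support lies in the
  index set of the final sum.\<close>

definition homogeneous :: "nat \<Rightarrow> nat \<Rightarrow> mpoly \<Rightarrow> bool" where
  "homogeneous n d p \<longleftrightarrow> Poly_Mapping.keys p \<subseteq> {\<alpha> \<in> multiindices n. mi_size n \<alpha> = d}"

lemma homogeneous_sum:
  assumes "\<And>a. a \<in> A \<Longrightarrow> homogeneous n d (f a)"
  shows "homogeneous n d (sum f A)"
  using assms keys_sum [of f A] unfolding homogeneous_def by fast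

lemma homogeneous_1: "homogeneous n 0 1"
  by (simp add: homogeneous_def multiindices_def mi_size_def)

lemma homogeneous_mult:
  assumes "homogeneous n d p" "homogeneous n e q"
  shows "homogeneous n (d + e) (p * q)"
proof -
  have "\<alpha> + \<beta> \<in> multiindices n \<and> mi_size n (\<alpha> + \<beta>) = d + e"
    if "\<alpha> \<in> Poly_Mapping.keys p" "\<beta> \<in> Poly_Mapping.keys q" for \<alpha> \<beta>
  proof
    show "\<alpha> + \<beta> \<in> multiindices n"
      using that assms keys_add [of \<alpha> \<beta>] unfolding homogeneous_def multiindices_def by blast
    have "mi_size n (\<alpha> + \<beta>) = mi_size n \<alpha> + mi_size n \<beta>"
      by (simp add: mi_size_def lookup_add sum.distrib)
    then show "mi_size n (\<alpha> + \<beta>) = d + e"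
      using that assms unfolding homogeneous_def by blast
  qed
  then show ?thesis
    using keys_mult [of p q] unfolding homogeneous_def by fast
qed

lemma homogeneous_signof_mult:
  "homogeneous n d p \<Longrightarrow> homogeneous n d (signof \<sigma> * p)"
  by (simp add: homogeneous_def sign_def)

lemma homogeneous_prod:
  assumes "\<And>a. a \<in> A \<Longrightarrow> homogeneous n 1 (f a)" "finite A"
  shows "homogeneous n (card A) (prod f A)"
  using assms(2,1)
proof (induction A rule: finite_induct)
  case (insert a A)
  then have "homogeneous n (1 + card A) (f a * prod f A)"
    by (intro homogeneous_mult) auto
  with insert.hyps show ?case by simp
qed (simp add: homogeneous_1)

lemma homogeneous_indet:
  assumes "i < n" "j < n"
  shows "homogeneous n 1 (indet i j)"
proof -
  have "mi_size n (Poly_Mapping.single (i, j) 1) = 1"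
  proof -
    have "mi_size n (Poly_Mapping.single (i, j) 1) =
        (\<Sum>i'<n. if i' = i then \<Sum>j'<n. if j' = j then 1 else 0 else 0)"
      unfolding mi_size_def by (intro sum.cong) (auto simp: lookup_single when_def)
    then show ?thesis using assms by simp
  qed
  then show ?thesis
    using assms by (simp add: homogeneous_def indet_def monomial_def multiindices_def)
qed

lemma homogeneous_det: "homogeneous n n (row_det n indet)"
  unfolding row_det_leibniz
proof (intro homogeneous_sum homogeneous_signof_mult)
  fix \<sigma> assume "\<sigma> \<in> {\<sigma>. \<sigma> permutes {0..<n}}"
  then have "\<sigma> i < n" if "i < n" for i
    using that permutes_in_image [of \<sigma> "{0..<n}" i] by auto
  then have "homogeneous n (card {0..<n}) (\<Prod>i = 0..<n. indet i (\<sigma> i))"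
    by (intro homogeneous_prod homogeneous_indet) auto
  then show "homogeneous n n (\<Prod>i = 0..<n. indet i (\<sigma> i))" by simp
qed

lemma homogeneous_det_power: "homogeneous n (k * n) (row_det n indet ^ k)"
  by (induction k) (simp_all add: homogeneous_1 homogeneous_mult homogeneous_det)

section \<open>The weighted coefficient sum as a Fischer norm\<close>

lemma mi_fact_eq_fact_mp:
  assumes "\<alpha> \<in> multiindices n"
  shows "mi_fact n \<alpha> = fact_mp \<alpha>"
  using fact_mp_superset [of "{..<n} \<times> {..<n}" \<alpha>] assms
  by (simp add: mi_fact_def multiindices_def prod.cartesian_product case_prod_beta)

theorem theorem2:
  fixes n k :: nat
  assumes "n \<ge> 1"
  shows "(\<Sum>\<alpha> \<in> {\<alpha> \<in> multiindices n. mi_size n \<alpha> = k * n}.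
            (coefficient (det (generic_mat n) ^ k) \<alpha>)\<^sup>2 * of_nat (mi_fact n \<alpha>))
         = (\<Prod>i<n. fact (k + i)) / (\<Prod>i<n. fact i)"
proof -
  have "det (generic_mat n) = row_det n indet"
    by (simp add: generic_mat_def row_det_def)
  \<comment> \<open>By homogeneity the sum over the support may be extended to all multiindices of
    size kn.\<close>
  moreover have "fischer (row_det n indet ^ k) (row_det n indet ^ k) =
      (\<Sum>\<alpha> \<in> {\<alpha> \<in> multiindices n. mi_size n \<alpha> = k * n}.
        (coefficient (row_det n indet ^ k) \<alpha>)\<^sup>2 * of_nat (mi_fact n \<alpha>))"
    using homogeneous_det_power [of n k]
    by (subst fischer_superset [OF finite_multiindices [of n "k * n"]])
      (auto simp: homogeneous_def power2_eq_square mi_fact_eq_fact_mp intro!: sum.cong)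
  ultimately show ?thesis
    by (simp add: fischer_det_power_self)
qed

end
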